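(* Let $\mathcal{R}$ be any complete representation. Every regular $\textsf{MRes-}\mathcal{R}$ refutation of $\textsf{CR}_n$ has size $2^{\Omega(n)}$.
   Context: The completion formulas: $\textsf{CR}_n = \exists \{x_{ij}\}_{i,j\in[n]}\ \forall z\ \exists \{a_i\}_{i\in[n]}\ \exists\{b_j\}_{j\in[n]}.\ \big(\bigwedge_{i,j\in[n]}(A_{ij}\wedge B_{ij})\big)\wedge L_A\wedge L_B$, where $A_{ij}=x_{ij}\vee z\vee a_i$, $B_{ij}=\overline{x_{ij}}\vee\bar z\vee b_j$, $L_A=\overline{a_1}\vee\dots\vee\overline{a_n}$, $L_B=\overline{b_1}\vee\dots\vee\overline{b_n}$. General setting: for a QBF $\Phi=Q.\phi$ in closed prenex CNF with existential variables $X$ and universal $U$, $y<_Q x$ means $y$ is in an earlier block, $L_Q(u)$ = existential variables left of $u$. Falsifying $u$-literal of $C\in\phi$: $0$ if $u\in C$, $1$ if $\bar u\in C$, $\ast$ otherwise; existential subclause = existential literals of $C$. A strategy for $u$ is a function from assignments of $L_Q(u)$ to $\{0,1,\ast\}$. $p\simeq q$ for $p,q\in\{0,1,\ast\}$ if $p=\ast$, $q=\ast$ or $p=q$; strategies consistent if pointwise consistent; $H\circ H'$ (for consistent $H,H'$) takes $H(\varepsilon)$ if $\ne\ast$ else $H'(\varepsilon)$; $H\overset{x}{\bowtie}H'$ is $H$ on $x=1$ and $H'$ on $x=0$. A representation is complete if every finite function has at least one representation in it. For a complete $\mathcal{R}$, an $\textsf{MRes-}\mathcal{R}$ derivation is a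 sequence of lines $(C_i,\{H^u_i:u\in U\})$, $C_i$ a clause of existential literals, $H^u_i$ strategies given in $\mathcal{R}$, each line either an axiom ($C_i$ the existential subclause of some $C\in\phi$, $H^u_i$ constant equal to the falsifying $u$-literal of $C$) or a resolution step ($a,b<i$, existential pivot $x$, $C_i=res(C_a,C_b,x)$ where $res(C\vee x,D\vee\bar x,x)=C\vee D$, and for each $u$: $H^u_i=H^u_b\overset{x}{\bowtie}H^u_a$ if $x<_Q u$; $H^u_a\simeq H^u_b$ and $H^u_i=H^u_a\circ H^u_b$ if $u<_Q x$). A refutation ends with the empty clause; its size is its number of lines. The derivation graph $G_\pi$ has lines as nodes and edges from hypotheses to resolvents. A refutation is regular if no leaf-to-root path in $G_\pi$ uses any existential variable as pivot more than once. *)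

theory Defs
  imports Complex_Main
begin

section \<open>Quantified Boolean formulas in prenex CNF\<close>

datatype 'v literal = Pos 'v | Neg 'v

fun var_of :: "'v literal \<Rightarrow> 'v" where
  "var_of (Pos v) = v"
| "var_of (Neg v) = v"

type_synonym 'v clause = "'v literal set"

datatype quantifier = Exist | Univ

text \<open>The prefix lists the quantifier blocks from left (outermost) to right.\<close>

record 'v qbf =
  prefix :: "(quantifier \<times> 'v set) list"
  matrix :: "'v clause set"

definition closed_prenex_cnf :: "'v qbf \<Rightarrow> bool" where
  "closed_prenex_cnf \<Phi> \<longleftrightarrow>
     (\<forall>(q, B) \<in> set (prefix \<Phi>). finite B) \<and>
     (\<forall>i < length (prefix \<Phi>). \<forall>j < length (prefix \<Phi>).
        i \<noteq> j \<longrightarrow> snd (prefix \<Phi> ! i) \<inter> snd (prefix \<Phi> ! j) = {}) \<and>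
     finite (matrix \<Phi>) \<and>
     (\<forall>C \<in> matrix \<Phi>. finite C \<and> var_of ` C \<subseteq> (\<Union>(q, B) \<in> set (prefix \<Phi>). B) \<and>
        (\<forall>v. \<not> (Pos v \<in> C \<and> Neg v \<in> C)))"

definition ex_vars :: "'v qbf \<Rightarrow> 'v set" where
  "ex_vars \<Phi> = {v. \<exists>B. (Exist, B) \<in> set (prefix \<Phi>) \<and> v \<in> B}"

definition univ_vars :: "'v qbf \<Rightarrow> 'v set" where
  "univ_vars \<Phi> = {v. \<exists>B. (Univ, B) \<in> set (prefix \<Phi>) \<and> v \<in> B}"

definition before :: "'v qbf \<Rightarrow> 'v \<Rightarrow> 'v \<Rightarrow> bool" where
  "before \<Phi> y x \<longleftrightarrow> (\<exists>i j. i < j \<and> j < length (prefix \<Phi>) \<and>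
     y \<in> snd (prefix \<Phi> ! i) \<and> x \<in> snd (prefix \<Phi> ! j))"

definition left_ex_vars :: "'v qbf \<Rightarrow> 'v \<Rightarrow> 'v set" where
  "left_ex_vars \<Phi> u = {x \<in> ex_vars \<Phi>. before \<Phi> x u}"

definition ex_subclause :: "'v qbf \<Rightarrow> 'v clause \<Rightarrow> 'v clause" where
  "ex_subclause \<Phi> C = {l \<in> C. var_of l \<in> ex_vars \<Phi>}"

section \<open>Strategies and their representations\<close>

datatype strat_value = Zero | One | Star

definition falsifying :: "'v \<Rightarrow> 'v clause \<Rightarrow> strat_value" where
  "falsifying u C = (if Pos u \<in> C then Zero else if Neg u \<in> C then One else Star)"

definition assignments :: "'v set \<Rightarrow> ('v \<rightharpoonup> bool) set" where
  "assignments V = {\<epsilon>. dom \<epsilon> = V}"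

text \<open>
  A strategy for \<open>u\<close> is a function on \<open>assignments (left_ex_vars \<Phi> u)\<close>; its values on other
  partial assignments are irrelevant, so strategies are compared only on this set.
\<close>

type_synonym 'v strategy = "('v \<rightharpoonup> bool) \<Rightarrow> strat_value"

definition strat_eq :: "'v set \<Rightarrow> 'v strategy \<Rightarrow> 'v strategy \<Rightarrow> bool" where
  "strat_eq V H H' \<longleftrightarrow> (\<forall>\<epsilon> \<in> assignments V. H \<epsilon> = H' \<epsilon>)"

definition value_consistent :: "strat_value \<Rightarrow> strat_value \<Rightarrow> bool" where
  "value_consistent p q \<longleftrightarrow> p = Star \<or> q = Star \<or> p = q"

definition strat_consistent :: "'v set \<Rightarrow> 'v strategy \<Rightarrow> 'v strategy \<Rightarrow> bool" where
  "strat_consistent V H H' \<longleftrightarrow> (\<forall>\<epsilon> \<in> assignments V. value_consistent (H \<epsilon>) (H' \<epsilon>))"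

definition strat_compose :: "'v strategy \<Rightarrow> 'v strategy \<Rightarrow> 'v strategy" where
  "strat_compose H H' = (\<lambda>\<epsilon>. if H \<epsilon> \<noteq> Star then H \<epsilon> else H' \<epsilon>)"

definition strat_merge :: "'v \<Rightarrow> 'v strategy \<Rightarrow> 'v strategy \<Rightarrow> 'v strategy" where
  "strat_merge x H H' = (\<lambda>\<epsilon>. if \<epsilon> x = Some True then H \<epsilon> else H' \<epsilon>)"

text \<open>
  A representation assigns to each code of type \<open>'r\<close> the function it represents. Read over a
  variable set \<open>V\<close>, the code stands for the restriction of that function to \<open>assignments V\<close>.
\<close>

type_synonym ('r, 'v) representation = "'r \<Rightarrow> 'v strategy"

definition complete_representation :: "('r, 'v) representation \<Rightarrow> bool" where
  "complete_representation R \<longleftrightarrow> (\<forall>V H. finite V \<longrightarrow> (\<exists>r. strat_eq V (R r) H))"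

section \<open>Merge resolution\<close>

text \<open>
  Every line records how it was inferred, so that the derivation graph and the pivots are
  determined by the derivation. Lines are numbered from 0.
\<close>

datatype 'v inference = Axiom "'v clause" | Resolve nat nat 'v

record ('r, 'v) proof_line =
  line_clause :: "'v clause"
  line_strat :: "'v \<Rightarrow> 'r"
  line_inference :: "'v inference"

type_synonym ('r, 'v) line_seq = "('r, 'v) proof_line list"

definition is_resolvent :: "'v clause \<Rightarrow> 'v clause \<Rightarrow> 'v \<Rightarrow> 'v clause \<Rightarrow> bool" where
  "is_resolvent Ca Cb x C \<longleftrightarrow>
     Pos x \<in> Ca \<and> Neg x \<in> Cb \<and> C = (Ca - {Pos x}) \<union> (Cb - {Neg x})"

definition axiom_line :: "('r, 'v) representation \<Rightarrow> 'v qbf \<Rightarrow> ('r, 'v) proof_line \<Rightarrow> 'v clause \<Rightarrow> bool"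
where
  "axiom_line R \<Phi> L C \<longleftrightarrow>
     C \<in> matrix \<Phi> \<and> line_clause L = ex_subclause \<Phi> C \<and>
     (\<forall>u \<in> univ_vars \<Phi>.
        strat_eq (left_ex_vars \<Phi> u) (R (line_strat L u)) (\<lambda>_. falsifying u C))"

definition resolution_line ::
  "('r, 'v) representation \<Rightarrow> 'v qbf \<Rightarrow> ('r, 'v) proof_line \<Rightarrow> ('r, 'v) proof_line \<Rightarrow>
   ('r, 'v) proof_line \<Rightarrow> 'v \<Rightarrow> bool"
where
  "resolution_line R \<Phi> L La Lb x \<longleftrightarrow>
     x \<in> ex_vars \<Phi> \<and> is_resolvent (line_clause La) (line_clause Lb) x (line_clause L) \<and>
     (\<forall>u \<in> univ_vars \<Phi>.
        let V = left_ex_vars \<Phi> u; H = R (line_strat L u);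
            Ha = R (line_strat La u); Hb = R (line_strat Lb u)
        in (before \<Phi> x u \<longrightarrow> strat_eq V H (strat_merge x Hb Ha)) \<and>
           (before \<Phi> u x \<longrightarrow> strat_consistent V Ha Hb \<and> strat_eq V H (strat_compose Ha Hb)))"

definition mres_derivation :: "('r, 'v) representation \<Rightarrow> 'v qbf \<Rightarrow> ('r, 'v) line_seq \<Rightarrow> bool" where
  "mres_derivation R \<Phi> \<pi> \<longleftrightarrow>
     (\<forall>i < length \<pi>. case line_inference (\<pi> ! i) of
        Axiom C \<Rightarrow> axiom_line R \<Phi> (\<pi> ! i) C
      | Resolve a b x \<Rightarrow> a < i \<and> b < i \<and> resolution_line R \<Phi> (\<pi> ! i) (\<pi> ! a) (\<pi> ! b) x)"

definition mres_refutation :: "('r, 'v) representation \<Rightarrow> 'v qbf \<Rightarrow> ('r, 'v) line_seq \<Rightarrow> bool" where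
  "mres_refutation R \<Phi> \<pi> \<longleftrightarrow>
     mres_derivation R \<Phi> \<pi> \<and> \<pi> \<noteq> [] \<and> line_clause (last \<pi>) = {}"

definition proof_size :: "('r, 'v) line_seq \<Rightarrow> nat" where
  "proof_size \<pi> = length \<pi>"

definition graph_edge :: "('r, 'v) line_seq \<Rightarrow> nat \<Rightarrow> nat \<Rightarrow> bool" where
  "graph_edge \<pi> j i \<longleftrightarrow> i < length \<pi> \<and>
     (\<exists>a b x. line_inference (\<pi> ! i) = Resolve a b x \<and> (j = a \<or> j = b))"

definition leaf_to_root_path :: "('r, 'v) line_seq \<Rightarrow> nat list \<Rightarrow> bool" where
  "leaf_to_root_path \<pi> p \<longleftrightarrow>
     p \<noteq> [] \<and> hd p < length \<pi> \<and> (\<exists>C. line_inference (\<pi> ! hd p) = Axiom C) \<and>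
     last p = length \<pi> - 1 \<and>
     (\<forall>k. Suc k < length p \<longrightarrow> graph_edge \<pi> (p ! k) (p ! Suc k))"

fun pivots :: "'v inference \<Rightarrow> 'v list" where
  "pivots (Axiom C) = []"
| "pivots (Resolve a b x) = [x]"

definition regular :: "('r, 'v) line_seq \<Rightarrow> bool" where
  "regular \<pi> \<longleftrightarrow> (\<forall>p. leaf_to_root_path \<pi> p \<longrightarrow>
     distinct (concat (map (\<lambda>i. pivots (line_inference (\<pi> ! i))) p)))"

section \<open>The completion formulas\<close>

datatype cr_var = X nat nat | Z | A nat | B nat

definition CR :: "nat \<Rightarrow> cr_var qbf" where
  "CR n = \<lparr>
     prefix = [(Exist, {X i j | i j. i \<in> {1..n} \<and> j \<in> {1..n}}),
               (Univ, {Z}),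
               (Exist, {A i | i. i \<in> {1..n}} \<union> {B j | j. j \<in> {1..n}})],
     matrix = {{Pos (X i j), Pos Z, Pos (A i)} | i j. i \<in> {1..n} \<and> j \<in> {1..n}}
            \<union> {{Neg (X i j), Neg Z, Pos (B j)} | i j. i \<in> {1..n} \<and> j \<in> {1..n}}
            \<union> {{Neg (A i) | i. i \<in> {1..n}}, {Neg (B j) | j. j \<in> {1..n}}} \<rparr>"

lemma closed_prenex_cnf_CR: "closed_prenex_cnf (CR n)"
proof -
  let ?I = "{1..n} \<times> {1..n}"
  have 1: "{X i j | i j. i \<in> {1..n} \<and> j \<in> {1..n}} = (\<lambda>(i, j). X i j) ` ?I"
    by auto
  have 2: "{{Pos (X i j), Pos Z, Pos (A i)} | i j. i \<in> {1..n} \<and> j \<in> {1..n}}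
      = (\<lambda>(i, j). {Pos (X i j), Pos Z, Pos (A i)}) ` ?I"
    by (auto; blast)
  have 3: "{{Neg (X i j), Neg Z, Pos (B j)} | i j. i \<in> {1..n} \<and> j \<in> {1..n}}
      = (\<lambda>(i, j). {Neg (X i j), Neg Z, Pos (B j)}) ` ?I"
    by (auto; blast)
  have fin: "finite (matrix (CR n))"
    unfolding CR_def 2 3 by simp
  have blocks: "\<forall>(q, B) \<in> set (prefix (CR n)). finite B"
    unfolding CR_def 1 by simp
  have disj: "\<forall>i < length (prefix (CR n)). \<forall>j < length (prefix (CR n)).
      i \<noteq> j \<longrightarrow> snd (prefix (CR n) ! i) \<inter> snd (prefix (CR n) ! j) = {}"
    by (auto simp: CR_def less_Suc_eq numeral_3_eq_3 nth_Cons')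
  have clauses: "\<forall>C \<in> matrix (CR n). finite C \<and>
      var_of ` C \<subseteq> (\<Union>(q, B) \<in> set (prefix (CR n)). B) \<and> (\<forall>v. \<not> (Pos v \<in> C \<and> Neg v \<in> C))"
    by (auto simp: CR_def)
  show ?thesis
    unfolding closed_prenex_cnf_def using fin blocks disj clauses by blast
qed

end

theory Submission
  imports Defs
begin

text \<open>
  Follow an assignment of the \<open>X\<close> variables from the empty clause upwards, always to the parent whose
  clause it falsifies, until the pivot is some \<open>a\<^sub>r\<close> or \<open>b\<^sub>r\<close>. The clause reached consists of \<open>X\<close>
  literals only, and it has at least \<open>n\<close> of them; since a clause of width \<open>n\<close> is falsified by a
  fraction \<open>2\<^bsup>-n\<^esup>\<close> of the assignments, there are at least \<open>2\<^bsup>n\<^esup>\<close> such lines.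

  For the width, let the pivot be \<open>a\<^sub>r\<close>, let \<open>C\<close> be the resolvent, and \<open>H\<^sub>+\<close>, \<open>H\<^sub>-\<close> the strategies of
  the parents containing \<open>a\<^sub>r\<close> and its negation. By regularity no axiom of row \<open>r\<close> of \<open>A\<close> occurs above
  the negative parent. If \<open>C\<close> contains some \<open>x\<^sub>r\<^sub>j\<close> positively, regularity forces the positive parent to
  be the axiom with strategy \<open>0\<close>; consistency then makes \<open>H\<^sub>-\<close> avoid \<open>1\<close>, which is unsound if some
  row can be set to all ones, so \<open>C\<close> has a positive literal in each row. Otherwise row \<open>r\<close> can be
  set to all ones, which forces \<open>H\<^sub>+ = 1\<close>; and if some column had no negative literal in \<open>C\<close>, setting it
  to zero outside row \<open>r\<close> would force \<open>H\<^sub>- = 0\<close>, since the axiom of \<open>B\<close> at that entry of row \<open>r\<close> is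
  not available above the negative parent. So \<open>C\<close> has a negative literal in each column.
\<close>

section \<open>Falsified clauses and the number of assignments falsifying them\<close>

fun sat :: "('v \<Rightarrow> bool) \<Rightarrow> 'v literal \<Rightarrow> bool" where
  "sat \<beta> (Pos v) = \<beta> v"
| "sat \<beta> (Neg v) = (\<not> \<beta> v)"

definition falsifies :: "('v \<Rightarrow> bool) \<Rightarrow> 'v clause \<Rightarrow> bool" where
  "falsifies \<beta> C \<longleftrightarrow> (\<forall>l\<in>C. \<not> sat \<beta> l)"

lemma sat_cong: "\<beta> (var_of l) = \<beta>' (var_of l) \<Longrightarrow> sat \<beta> l = sat \<beta>' l"
  by (cases l) auto

text \<open>Test assignments can be prescribed freely off the variables of \<open>C\<close> while
  \<open>C\<close> stays falsified.\<close>

definition override :: "'v clause \<Rightarrow> ('v \<Rightarrow> bool) \<Rightarrow> ('v \<Rightarrow> bool) \<Rightarrow> 'v \<Rightarrow> bool" where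
  "override C \<alpha> \<gamma> v = (if v \<in> var_of ` C then \<alpha> v else \<gamma> v)"

lemma falsifies_override: "falsifies \<alpha> C \<Longrightarrow> falsifies (override C \<alpha> \<gamma>) C"
  unfolding falsifies_def by (metis image_eqI override_def sat_cong)

lemma sat_override_other: "var_of l \<notin> var_of ` C \<Longrightarrow> sat (override C \<alpha> \<gamma>) l = sat \<gamma> l"
  by (rule sat_cong) (simp add: override_def)

text \<open>If the variable of \<open>l\<close> occurs in \<open>C\<close>, it does so through the
  complement of \<open>l\<close>, which is falsified.\<close>

lemma sat_override:
  assumes "falsifies \<alpha> C" "l \<notin> C" "sat \<gamma> l"
  shows "sat (override C \<alpha> \<gamma>) l"
proof (cases "var_of l \<in> var_of ` C")
  case True
  then obtain l' where l': "l' \<in> C" "var_of l = var_of l'" by auto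
  then have "\<not> sat (override C \<alpha> \<gamma>) l'"
    using falsifies_override[OF assms(1)] by (auto simp: falsifies_def)
  moreover have "l \<noteq> l'" using l' assms(2) by auto
  ultimately show ?thesis using l'(2) by (cases l; cases l') auto
next
  case False
  with assms(3) show ?thesis by (simp add: sat_override_other)
qed

definition restrict_asg :: "'v set \<Rightarrow> ('v \<Rightarrow> bool) \<Rightarrow> 'v \<rightharpoonup> bool" where
  "restrict_asg V \<beta> = (\<lambda>v. if v \<in> V then Some (\<beta> v) else None)"

lemma restrict_asg_in_assignments: "restrict_asg V \<beta> \<in> assignments V"
  by (auto simp: restrict_asg_def assignments_def dom_def)

lemma restrict_asg_cong: "(\<And>v. v \<in> V \<Longrightarrow> \<beta> v = \<beta>' v) \<Longrightarrow> restrict_asg V \<beta> = restrict_asg V \<beta>'"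
  by (auto simp: restrict_asg_def)

text \<open>Falsifying \<open>C\<close> fixes the values on its variables, so \<open>T\<close> is
  determined by its remaining part. There are as many variables as literals, since a falsified
  clause has no complementary pair.\<close>

lemma card_falsifying_subsets:
  assumes "finite V" "finite C" "var_of ` C \<subseteq> V" "k \<le> card C"
  shows "card {T \<in> Pow V. falsifies (\<lambda>v. v \<in> T) C} * 2 ^ k \<le> 2 ^ card V"
proof (cases "\<exists>\<alpha>. falsifies \<alpha> C")
  case False
  then show ?thesis by simp
next
  case True
  then obtain \<alpha> where \<alpha>: "falsifies \<alpha> C" by blast
  define W where "W = var_of ` C"
  let ?F = "{T \<in> Pow V. falsifies (\<lambda>v. v \<in> T) C}"
  have "inj_on var_of C"
  proof (rule inj_onI)
    fix l l' assume "l \<in> C" "l' \<in> C" "var_of l = var_of l'"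
    moreover from this have "\<not> sat \<alpha> l" "\<not> sat \<alpha> l'"
      using \<alpha> by (auto simp: falsifies_def)
    ultimately show "l = l'" by (cases l; cases l') auto
  qed
  then have cW: "card W = card C"
    by (simp add: W_def card_image)
  have "inj_on (\<lambda>T. T - W) ?F"
  proof (rule inj_onI)
    fix T T' assume T: "T \<in> ?F" "T' \<in> ?F" "T - W = T' - W"
    have "v \<in> T \<longleftrightarrow> v \<in> T'" if "v \<in> W" for v
    proof -
      from that obtain l where "l \<in> C" "v = var_of l" by (auto simp: W_def)
      with T(1,2) show ?thesis by (cases l) (force simp: falsifies_def)+
    qed
    with T(3) show "T = T'" by blast
  qed
  moreover have "(\<lambda>T. T - W) ` ?F \<subseteq> Pow (V - W)" by auto
  ultimately have "card ?F \<le> card (Pow (V - W))"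
    using assms(1) by (intro card_inj_on_le) auto
  also have "\<dots> = 2 ^ (card V - card W)"
    using assms by (simp add: card_Pow card_Diff_subset W_def finite_subset)
  finally have "card ?F * 2 ^ k \<le> 2 ^ (card V - card W) * 2 ^ card W"
    using assms(4) cW by (intro mult_mono power_increasing) auto
  also have "\<dots> = 2 ^ card V"
    using card_mono[OF assms(1,3)] by (simp add: W_def flip: power_add)
  finally show ?thesis .
qed

section \<open>Literals and clauses of the completion formulas\<close>

text \<open>
  Swapping the two coordinates and the two truth values exchanges the roles of \<open>A\<close> and \<open>B\<close>.
  The polarity \<open>s\<close> treats both sides at once; the complement of \<open>xlit s i j\<close> is \<open>xlit (\<not> s) j i\<close>.
\<close>

definition xvar :: "bool \<Rightarrow> nat \<Rightarrow> nat \<Rightarrow> cr_var" where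
  "xvar s i j = (if s then X i j else X j i)"

definition xlit :: "bool \<Rightarrow> nat \<Rightarrow> nat \<Rightarrow> cr_var literal" where
  "xlit s i j = (if s then Pos (X i j) else Neg (X j i))"

definition zlit :: "bool \<Rightarrow> cr_var literal" where
  "zlit s = (if s then Pos Z else Neg Z)"

definition cvar :: "bool \<Rightarrow> nat \<Rightarrow> cr_var" where
  "cvar s i = (if s then A i else B i)"

definition short_clause :: "bool \<Rightarrow> nat \<Rightarrow> nat \<Rightarrow> cr_var clause" where
  "short_clause s i j = {xlit s i j, zlit s, Pos (cvar s i)}"

definition long_clause :: "nat \<Rightarrow> bool \<Rightarrow> cr_var clause" where
  "long_clause n s = {Neg (cvar s i) | i. i \<in> {1..n}}"

definition zval :: "bool \<Rightarrow> strat_value" where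
  "zval b = (if b then One else Zero)"

definition xvars :: "nat \<Rightarrow> cr_var set" where
  "xvars n = {X i j | i j. i \<in> {1..n} \<and> j \<in> {1..n}}"

definition cvars :: "nat \<Rightarrow> cr_var set" where
  "cvars n = {cvar s i | s i. i \<in> {1..n}}"

lemma xvars_eq_image: "xvars n = (\<lambda>(i, j). X i j) ` ({1..n} \<times> {1..n})"
  by (auto simp: xvars_def)

lemma finite_xvars: "finite (xvars n)"
  by (simp add: xvars_eq_image)

lemma var_of_xlit [simp]: "var_of (xlit s i j) = xvar s i j"
  by (simp add: xlit_def xvar_def)

lemma xvar_in_xvars [simp]: "xvar s i j \<in> xvars n \<longleftrightarrow> i \<in> {1..n} \<and> j \<in> {1..n}"
  by (auto simp: xvar_def xvars_def)

lemma sat_zlit: "sat \<beta> (zlit s) \<longleftrightarrow> \<beta> Z = s"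
  by (simp add: zlit_def)

lemma xvar_flip: "xvar (\<not> s) j i = xvar s i j"
  by (simp add: xvar_def)

lemma matrix_CR:
  "matrix (CR n) = {short_clause s i j | s i j. i \<in> {1..n} \<and> j \<in> {1..n}} \<union> range (long_clause n)"
proof -
  have "matrix (CR n) = {short_clause True i j | i j. i \<in> {1..n} \<and> j \<in> {1..n}}
      \<union> {short_clause False j i | i j. i \<in> {1..n} \<and> j \<in> {1..n}}
      \<union> {long_clause n True, long_clause n False}"
    by (simp add: CR_def short_clause_def xlit_def zlit_def cvar_def long_clause_def)
  also have "\<dots> = {short_clause s i j | s i j. i \<in> {1..n} \<and> j \<in> {1..n}} \<union> range (long_clause n)"
    unfolding ex_bool_eq UNIV_bool by blast
  finally show ?thesis .
qed

lemma cvars_eq: "cvars n = {A i | i. i \<in> {1..n}} \<union> {B j | j. j \<in> {1..n}}"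
  by (auto simp: cvars_def cvar_def)

lemma prefix_CR: "prefix (CR n) = [(Exist, xvars n), (Univ, {Z}), (Exist, cvars n)]"
  by (simp add: CR_def xvars_def cvars_eq)

lemma ex_vars_CR: "ex_vars (CR n) = xvars n \<union> cvars n"
  by (auto simp: ex_vars_def prefix_CR)

lemma univ_vars_CR: "univ_vars (CR n) = {Z}"
  by (auto simp: univ_vars_def prefix_CR)

lemma Z_notin [simp]: "Z \<notin> xvars n" "Z \<notin> cvars n"
  by (auto simp: xvars_def cvars_eq)

lemma cvar_notin_xvars [simp]: "cvar s i \<notin> xvars n"
  by (auto simp: xvars_def cvar_def)

lemma before_Z: "before (CR n) x Z \<longleftrightarrow> x \<in> xvars n"
proof
  assume "before (CR n) x Z"
  then show "x \<in> xvars n"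
    by (auto simp: before_def prefix_CR less_Suc_eq numeral_3_eq_3 nth_Cons')
next
  assume "x \<in> xvars n"
  then show "before (CR n) x Z"
    unfolding before_def prefix_CR by (intro exI[of _ 0] exI[of _ 1]) auto
qed

lemma Z_before: "x \<in> cvars n \<Longrightarrow> before (CR n) Z x"
  unfolding before_def prefix_CR by (intro exI[of _ 1] exI[of _ 2]) auto

lemma left_ex_vars_CR: "left_ex_vars (CR n) Z = xvars n"
  by (auto simp: left_ex_vars_def before_Z ex_vars_CR)

lemma matrix_CR_cases:
  assumes "C \<in> matrix (CR n)"
  obtains i j where "i \<in> {1..n}" "j \<in> {1..n}" "C = short_clause s i j"
  | i j where "i \<in> {1..n}" "j \<in> {1..n}" "C = short_clause (\<not> s) i j"
  | "C = long_clause n s"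
  | "C = long_clause n (\<not> s)"
proof -
  from assms consider s' i j where "i \<in> {1..n}" "j \<in> {1..n}" "C = short_clause s' i j"
    | s' where "C = long_clause n s'"
    unfolding matrix_CR by blast
  then show thesis
  proof cases
    case 1
    then show thesis using that(1,2) by (cases "s' = s") auto
  next
    case 2
    then show thesis using that(3,4) by (cases "s' = s") auto
  qed
qed

text \<open>
  The assignment under which the literals \<open>xlit s i j\<close>, \<open>zlit s\<close>, \<open>cvar s i\<close>, \<open>cvar (\<not> s) i\<close> have
  the truth values \<open>Q i j\<close>, \<open>z\<close>, \<open>f i\<close>, \<open>h i\<close>.
\<close>

definition cr_asg ::
  "bool \<Rightarrow> (nat \<Rightarrow> nat \<Rightarrow> bool) \<Rightarrow> bool \<Rightarrow> (nat \<Rightarrow> bool) \<Rightarrow> (nat \<Rightarrow> bool) \<Rightarrow> cr_var \<Rightarrow> bool"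
where
  "cr_asg s Q z f h v = (case v of
     X i j \<Rightarrow> if s then Q i j else \<not> Q j i
   | Z \<Rightarrow> z = s
   | A i \<Rightarrow> if s then f i else h i
   | B i \<Rightarrow> if s then h i else f i)"

lemma cr_asg_simps:
  "sat (cr_asg s Q z f h) (xlit s i j) = Q i j"
  "sat (cr_asg s Q z f h) (xlit (\<not> s) i j) = (\<not> Q j i)"
  "cr_asg s Q z f h Z = (z = s)"
  "cr_asg s Q z f h (cvar s i) = f i"
  "cr_asg s Q z f h (cvar (\<not> s) i) = h i"
  by (auto simp: cr_asg_def xlit_def cvar_def)

lemma not_consistent_zvalD: "\<not> value_consistent p (zval z) \<Longrightarrow> p = zval (\<not> z)"
  by (cases p) (auto simp: value_consistent_def zval_def split: if_splits)

text \<open>Each \<open>X\<close> literal has a single source in the matrix, so its presence in a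
  derived clause reveals an axiom used above.\<close>

lemma xlit_in_matrix_clause:
  assumes "C \<in> matrix (CR n)" "xlit s i j \<in> C"
  shows "C = short_clause s i j"
  using assms
  by (auto simp: matrix_CR short_clause_def long_clause_def xlit_def zlit_def cvar_def
      split: if_splits)

lemma ex_subclause_short_clause:
  assumes "i \<in> {1..n}" "j \<in> {1..n}"
  shows "ex_subclause (CR n) (short_clause s i j) = {xlit s i j, Pos (cvar s i)}"
proof -
  have "cvar s i \<in> cvars n" using assms by (auto simp: cvars_def)
  then show ?thesis
    using assms by (auto simp: ex_subclause_def short_clause_def ex_vars_CR zlit_def)
qed

lemma falsifying_short_clause: "falsifying Z (short_clause s i j) = zval (\<not> s)"
  by (auto simp: falsifying_def short_clause_def zval_def xlit_def zlit_def cvar_def)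

section \<open>Derivation graphs of regular refutations\<close>

locale cr_refutation =
  fixes R :: "('r, cr_var) representation" and n :: nat and \<pi> :: "('r, cr_var) line_seq"
  assumes refutation: "mres_refutation R (CR n) \<pi>" and regular: "regular \<pi>" and n_ge_2: "2 \<le> n"
begin

abbreviation clause :: "nat \<Rightarrow> cr_var clause" where "clause i \<equiv> line_clause (\<pi> ! i)"
abbreviation strat :: "nat \<Rightarrow> cr_var strategy" where "strat i \<equiv> R (line_strat (\<pi> ! i) Z)"
abbreviation inference :: "nat \<Rightarrow> cr_var inference" where "inference i \<equiv> line_inference (\<pi> ! i)"
abbreviation edge :: "nat \<Rightarrow> nat \<Rightarrow> bool" where "edge \<equiv> graph_edge \<pi>"
abbreviation root :: nat where "root \<equiv> length \<pi> - 1"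
abbreviation pivot_at :: "nat \<Rightarrow> cr_var \<Rightarrow> bool" where
  "pivot_at i x \<equiv> \<exists>a b. inference i = Resolve a b x"

lemma length_pos: "0 < length \<pi>"
  using refutation by (auto simp: mres_refutation_def)

lemma clause_root: "clause root = {}"
  using refutation by (auto simp: mres_refutation_def last_conv_nth)

lemma axiomD:
  assumes "i < length \<pi>" "inference i = Axiom C"
  shows "C \<in> matrix (CR n)" "clause i = ex_subclause (CR n) C"
    and "\<epsilon> \<in> assignments (xvars n) \<Longrightarrow> strat i \<epsilon> = falsifying Z C"
  using refutation assms
  unfolding mres_refutation_def mres_derivation_def
  by (auto simp: axiom_line_def univ_vars_CR left_ex_vars_CR strat_eq_def)

lemma resolveD:
  assumes "i < length \<pi>" "inference i = Resolve a b x"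
  shows "a < i" "b < i" "edge a i" "edge b i" "x \<in> xvars n \<union> cvars n"
    "Pos x \<in> clause a" "Neg x \<in> clause b"
    "clause i = (clause a - {Pos x}) \<union> (clause b - {Neg x})"
    and "x \<in> xvars n \<Longrightarrow> \<epsilon> \<in> assignments (xvars n) \<Longrightarrow>
      strat i \<epsilon> = (if \<epsilon> x = Some True then strat b \<epsilon> else strat a \<epsilon>)"
    and "x \<in> cvars n \<Longrightarrow> \<epsilon> \<in> assignments (xvars n) \<Longrightarrow>
      value_consistent (strat a \<epsilon>) (strat b \<epsilon>) \<and>
      strat i \<epsilon> = (if strat a \<epsilon> \<noteq> Star then strat a \<epsilon> else strat b \<epsilon>)"
proof -
  have *: "a < i \<and> b < i \<and> resolution_line R (CR n) (\<pi> ! i) (\<pi> ! a) (\<pi> ! b) x"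
    using refutation assms by (force simp: mres_refutation_def mres_derivation_def)
  then show "a < i" "b < i" by auto
  show "edge a i" "edge b i" using assms by (auto simp: graph_edge_def)
  show "x \<in> xvars n \<union> cvars n" "Pos x \<in> clause a" "Neg x \<in> clause b"
    "clause i = (clause a - {Pos x}) \<union> (clause b - {Neg x})"
    using * by (auto simp: resolution_line_def is_resolvent_def ex_vars_CR)
  show "strat i \<epsilon> = (if \<epsilon> x = Some True then strat b \<epsilon> else strat a \<epsilon>)"
    if "x \<in> xvars n" "\<epsilon> \<in> assignments (xvars n)"
    using * that
    by (auto simp: resolution_line_def univ_vars_CR before_Z left_ex_vars_CR strat_eq_def
        strat_merge_def Let_def)
  show "value_consistent (strat a \<epsilon>) (strat b \<epsilon>) \<and>
      strat i \<epsilon> = (if strat a \<epsilon> \<noteq> Star then strat a \<epsilon> else strat b \<epsilon>)"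
    if "x \<in> cvars n" "\<epsilon> \<in> assignments (xvars n)"
    using * that
    by (auto simp: resolution_line_def univ_vars_CR Z_before left_ex_vars_CR strat_eq_def
        strat_compose_def strat_consistent_def Let_def)
qed

lemma edgeE:
  assumes "edge j i"
  obtains a b x where "i < length \<pi>" "inference i = Resolve a b x" "j = a \<or> j = b"
  using assms by (auto simp: graph_edge_def)

lemma edge_less: "edge j i \<Longrightarrow> j < i \<and> i < length \<pi>"
  by (elim edgeE) (use resolveD(1,2) in blast)

lemma reach_less: "edge\<^sup>*\<^sup>* j i \<Longrightarrow> i < length \<pi> \<Longrightarrow> j < length \<pi>"
  by (induction rule: converse_rtranclp_induct) (auto dest: edge_less)

lemma leaf_above: "i < length \<pi> \<Longrightarrow> \<exists>k C. edge\<^sup>*\<^sup>* k i \<and> inference k = Axiom C"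
proof (induction i rule: less_induct)
  case (less i)
  show ?case
  proof (cases "inference i")
    case (Resolve a b x)
    with less resolveD(1,3)[OF less.prems Resolve] show ?thesis
      by (meson order.strict_trans rtranclp.rtrancl_into_rtrancl)
  qed auto
qed

lemma reach_path: "edge\<^sup>*\<^sup>* j i \<Longrightarrow> \<exists>p. p \<noteq> [] \<and> hd p = j \<and> last p = i \<and> successively edge p"
proof (induction rule: rtranclp_induct)
  case base
  show ?case by (intro exI[of _ "[j]"]) auto
next
  case (step y z)
  then obtain p where "p \<noteq> []" "hd p = j" "last p = y" "successively edge p" by blast
  with step(2) show ?case
    by (intro exI[of _ "p @ [z]"]) (auto simp: successively_append_iff)
qed

lemma regularD:
  assumes ji: "edge\<^sup>+\<^sup>+ j i" and ir: "edge\<^sup>*\<^sup>* i root" and "pivot_at j x" "pivot_at i x"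
  shows False
proof -
  have "i < length \<pi>" using reach_less[OF ir] length_pos by simp
  then have "j < length \<pi>" using reach_less ji by (meson tranclp_into_rtranclp)
  then obtain k C where k: "edge\<^sup>*\<^sup>* k j" "inference k = Axiom C" using leaf_above by blast
  \<comment> \<open>Starting \<open>q\<close> at the successor of \<open>j\<close> keeps
    \<open>p\<close> and \<open>q\<close> separate pieces of one path, so \<open>x\<close> is listed
    twice among its pivots. The tail \<open>t\<close> is empty if \<open>i\<close> is the
    root.\<close>
  obtain j' where j': "edge j j'" "edge\<^sup>*\<^sup>* j' i" using ji by (meson tranclpD)
  obtain p q where p: "p \<noteq> []" "hd p = k" "last p = j" "successively edge p"
    and q: "q \<noteq> []" "hd q = j'" "last q = i" "successively edge q"
    using reach_path[OF k(1)] reach_path[OF j'(2)] by blast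
  have "\<exists>t. successively edge (i # t) \<and> last (i # t) = root"
  proof -
    obtain t where "t \<noteq> []" "hd t = i" "last t = root" "successively edge t"
      using reach_path[OF ir] by blast
    then show ?thesis by (intro exI[of _ "tl t"]) (metis list.collapse)
  qed
  then obtain t where t: "successively edge (i # t)" "last (i # t) = root" by blast
  let ?p = "p @ q @ t"
  have s: "successively edge ?p"
    using p q t j' by (auto simp: successively_append_iff successively_Cons)
  have "last ?p = root" using p q t by (cases t) auto
  then have "leaf_to_root_path \<pi> ?p"
    using p k reach_less[OF k(1) \<open>j < length \<pi>\<close>] s
    by (auto simp: leaf_to_root_path_def successively_conv_nth)
  then have "distinct (concat (map (\<lambda>i. pivots (inference i)) ?p))"
    using regular unfolding regular_def by blast
  moreover have "j \<in> set p" "i \<in> set q" using p q last_in_set by blast+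
  moreover have "x \<in> set (pivots (inference j))" "x \<in> set (pivots (inference i))"
    using assms(3,4) by auto
  ultimately show False by auto
qed

text \<open>A resolution step drops only literals on its pivot variable.\<close>

lemma literal_persists:
  assumes "edge\<^sup>*\<^sup>* k i" "l \<in> clause k"
  shows "l \<in> clause i \<or> (\<exists>p. edge\<^sup>+\<^sup>+ k p \<and> edge\<^sup>*\<^sup>* p i \<and> pivot_at p (var_of l))"
  using assms
proof (induction rule: rtranclp_induct)
  case base
  then show ?case by simp
next
  case (step y z)
  from step(2) obtain a b x where e: "z < length \<pi>" "inference z = Resolve a b x" "y = a \<or> y = b"
    by (rule edgeE)
  from step have "l \<in> clause y \<or> (\<exists>p. edge\<^sup>+\<^sup>+ k p \<and> edge\<^sup>*\<^sup>* p z \<and> pivot_at p (var_of l))"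
    by (meson rtranclp.rtrancl_into_rtrancl)
  moreover have "l \<in> clause z \<or> pivot_at z (var_of l)" if "l \<in> clause y"
  proof (cases "l \<in> clause z")
    case False
    then have "l = Pos x \<or> l = Neg x"
      using that e(3) resolveD(8)[OF e(1,2)] by blast
    with e(2) show ?thesis by auto
  qed simp
  moreover have "edge\<^sup>+\<^sup>+ k z" using step(1,2) by (rule rtranclp_into_tranclp1)
  ultimately show ?case by blast
qed

lemma literal_origin:
  assumes "i < length \<pi>" "l \<in> clause i"
  shows "\<exists>k C. edge\<^sup>*\<^sup>* k i \<and> inference k = Axiom C \<and> l \<in> C"
  using assms
proof (induction i rule: less_induct)
  case (less i)
  show ?case
  proof (cases "inference i")
    case (Axiom C)
    with less.prems axiomD(2)[OF less.prems(1) Axiom] show ?thesis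
      by (auto simp: ex_subclause_def)
  next
    case (Resolve a b x)
    note r = resolveD[OF less.prems(1) Resolve]
    from less.prems r(8) obtain c where c: "c = a \<or> c = b" "l \<in> clause c" by blast
    then have "c < i" "edge c i" using r by auto
    with less c(2) show ?thesis
      by (meson order.strict_trans rtranclp.rtrancl_into_rtrancl)
  qed
qed

text \<open>The root clause is empty, so the literal is resolved away strictly below
  \<open>i\<close>; regularity then excludes the same pivot at \<open>i\<close> and above.\<close>

lemma no_pivot_above_literal:
  assumes "edge\<^sup>*\<^sup>* i root" "l \<in> clause i" "edge\<^sup>*\<^sup>* k i"
  shows "\<not> pivot_at k (var_of l)"
proof
  assume "pivot_at k (var_of l)"
  moreover obtain p where "edge\<^sup>+\<^sup>+ i p" "edge\<^sup>*\<^sup>* p root" "pivot_at p (var_of l)"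
    using literal_persists[OF assms(1,2)] clause_root by auto
  ultimately show False
    using regularD assms(3) by (meson rtranclp_tranclp_tranclp)
qed

text \<open>
  Unlike the usual soundness of merge resolution, the falsified clause is found among the axioms
  actually used above the line.
\<close>

lemma soundness:
  assumes "i < length \<pi>" "falsifies \<beta> (clause i)"
    and "value_consistent (strat i (restrict_asg (xvars n) \<beta>)) (zval (\<beta> Z))"
  shows "\<exists>k C. edge\<^sup>*\<^sup>* k i \<and> inference k = Axiom C \<and> C \<in> matrix (CR n) \<and> falsifies \<beta> C"
  using assms
proof (induction i rule: less_induct)
  case (less i)
  let ?\<epsilon> = "restrict_asg (xvars n) \<beta>"
  note \<epsilon> = restrict_asg_in_assignments[of "xvars n" \<beta>]
  show ?case
  proof (cases "inference i")
    case (Axiom C)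
    note a = axiomD[OF less.prems(1) Axiom]
    have "\<not> sat \<beta> l" if "l \<in> C" for l
    proof (cases "var_of l \<in> ex_vars (CR n)")
      case True
      with that a(2) less.prems(2) show ?thesis by (auto simp: falsifies_def ex_subclause_def)
    next
      case False
      have C: "var_of ` C \<subseteq> ex_vars (CR n) \<union> {Z}" "\<not> (Pos Z \<in> C \<and> Neg Z \<in> C)"
        using closed_prenex_cnf_CR[of n] a(1)
        unfolding closed_prenex_cnf_def by (auto simp: prefix_CR ex_vars_CR)
      with False that have "var_of l = Z" by auto
      with that C(2) less.prems(3) a(3)[OF \<epsilon>] show ?thesis
        by (cases l) (auto simp: falsifying_def value_consistent_def zval_def split: if_splits)
    qed
    with Axiom a(1) show ?thesis unfolding falsifies_def by blast
  next
    case (Resolve a b x)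
    note r = resolveD[OF less.prems(1) Resolve]
    define c where "c = (if \<beta> x then b else a)"
    have c: "c < i" "edge c i" using r by (auto simp: c_def)
    have "falsifies \<beta> (clause c)"
      unfolding falsifies_def
    proof
      fix l assume "l \<in> clause c"
      then have "l \<in> clause i \<or> l = (if \<beta> x then Neg x else Pos x)"
        using r(8) by (auto simp: c_def split: if_splits)
      with less.prems(2) show "\<not> sat \<beta> l" by (cases "\<beta> x") (auto simp: falsifies_def)
    qed
    \<comment> \<open>For a pivot in the first block, the merge copies the strategy of
      \<open>c\<close> at this assignment. For one in the third block, the parents agree up to
      \<open>Star\<close>, so a Boolean move consistent with the composition is consistent with
      both.\<close>
    moreover have "value_consistent (strat c ?\<epsilon>) (zval (\<beta> Z))"
    proof (cases "x \<in> xvars n")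
      case True
      with r(9)[OF True \<epsilon>] less.prems(3) show ?thesis
        by (auto simp: c_def restrict_asg_def)
    next
      case False
      then have "x \<in> cvars n" using r(5) by blast
      with r(10)[OF this \<epsilon>] less.prems(3) show ?thesis
        by (auto simp: c_def value_consistent_def split: if_splits)
    qed
    ultimately have "\<exists>k C. edge\<^sup>*\<^sup>* k c \<and> inference k = Axiom C \<and> C \<in> matrix (CR n) \<and> falsifies \<beta> C"
      using less.IH c(1) less.prems(1) by auto
    with c(2) show ?thesis by (meson rtranclp.rtrancl_into_rtrancl)
  qed
qed

lemma strat_forced:
  assumes "i < length \<pi>" "falsifies \<beta> (clause i)"
    and "\<And>k C. edge\<^sup>*\<^sup>* k i \<Longrightarrow> inference k = Axiom C \<Longrightarrow> C \<in> matrix (CR n) \<Longrightarrow> \<not> falsifies \<beta> C"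
  shows "strat i (restrict_asg (xvars n) \<beta>) = zval (\<not> \<beta> Z)"
  using soundness[OF assms(1,2)] assms(3) not_consistent_zvalD by blast

section \<open>Width at the last resolution over the third block\<close>

lemma wide_clause:
  assumes ir: "edge\<^sup>*\<^sup>* i root" and inf: "inference i = Resolve a b (cvar s r)"
    and r: "r \<in> {1..n}" and sub: "var_of ` clause i \<subseteq> xvars n"
    and \<alpha>: "falsifies \<alpha> (clause i)"
  shows "n \<le> card (clause i)"
proof -
  let ?C = "clause i" and ?y = "cvar s r"
  have il: "i < length \<pi>" using reach_less[OF ir] length_pos by simp
  note res = resolveD[OF il inf]
  have al: "a < length \<pi>" and bl: "b < length \<pi>" using res(1,2) il by auto
  have cv: "cvar t k \<in> cvars n" if "k \<in> {1..n}" for t k using that by (auto simp: cvars_def)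
  have noC: "Pos (cvar t k) \<notin> ?C" "Neg (cvar t k) \<notin> ?C" for t k
    using sub by force+
  have cvC: "cvar t k \<notin> var_of ` ?C" "Z \<notin> var_of ` ?C" for t k
    using sub cvar_notin_xvars Z_notin(1) by blast+
  have finC: "finite ?C"
  proof -
    have "?C \<subseteq> Pos ` xvars n \<union> Neg ` xvars n"
    proof
      fix l assume "l \<in> ?C"
      with sub show "l \<in> Pos ` xvars n \<union> Neg ` xvars n" by (cases l) force+
    qed
    then show ?thesis using finite_xvars finite_subset by blast
  qed
  have no_pivot_y: "\<not> pivot_at k ?y" if "edge\<^sup>*\<^sup>* k c" "c = a \<or> c = b" for k c
  proof -
    have "edge\<^sup>+\<^sup>+ k i" using that res(3,4) by (auto intro: rtranclp_into_tranclp1)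
    with regularD[OF _ ir] inf show ?thesis by blast
  qed
  \<comment> \<open>The axiom would bring in \<open>Pos ?y\<close>, which no pivot above
    \<open>b\<close> removes; it would pass through \<open>b\<close> into \<open>?C\<close>.\<close>
  have b_no_short: False if "edge\<^sup>*\<^sup>* k b" "inference k = Axiom (short_clause s r j)" for k j
  proof -
    have kl: "k < length \<pi>" using reach_less[OF that(1) bl] .
    have "?y \<in> ex_vars (CR n)" using cv[OF r] by (auto simp: ex_vars_CR)
    then have "Pos ?y \<in> clause k"
      using axiomD(2)[OF kl that(2)] by (auto simp: ex_subclause_def short_clause_def)
    from literal_persists[OF that(1) this] no_pivot_y have "Pos ?y \<in> clause b" by auto
    with res(8) noC show False by auto
  qed
  have b_no_xlit: "xlit s r j \<notin> clause k" if "edge\<^sup>*\<^sup>* k b" for k j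
  proof
    assume "xlit s r j \<in> clause k"
    with literal_origin reach_less[OF that bl] obtain k' D where
      k': "edge\<^sup>*\<^sup>* k' k" "inference k' = Axiom D" "xlit s r j \<in> D" by blast
    have k'b: "edge\<^sup>*\<^sup>* k' b" using k'(1) that by simp
    then have "D \<in> matrix (CR n)" using axiomD(1) k'(2) reach_less[OF _ bl] by blast
    then have "D = short_clause s r j" using k'(3) by (rule xlit_in_matrix_clause)
    with b_no_short[OF k'b] k'(2) show False by blast
  qed
  \<comment> \<open>Removing this literal above \<open>b\<close> would need the complement
    \<open>xlit s r j\<close> as a partner, which does not occur there.\<close>
  have b_compl_short: "xlit (\<not> s) j r \<in> ?C"
    if "edge\<^sup>*\<^sup>* k b" "inference k = Axiom (short_clause (\<not> s) j r)" "j \<in> {1..n}" for k j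
  proof -
    have kl: "k < length \<pi>" using reach_less[OF that(1) bl] .
    have "xlit (\<not> s) j r \<in> clause k"
      using axiomD(2)[OF kl that(2)] ex_subclause_short_clause[OF that(3) r] by auto
    moreover have "\<not> pivot_at p (xvar s r j)" if "edge\<^sup>*\<^sup>* p b" for p
    proof
      assume "pivot_at p (xvar s r j)"
      then obtain c d where p: "inference p = Resolve c d (xvar s r j)" by blast
      note q = resolveD[OF reach_less[OF that bl] p]
      have "edge\<^sup>*\<^sup>* c b" "edge\<^sup>*\<^sup>* d b" using q(3,4) that by auto
      from this[THEN b_no_xlit, of j] q(6,7) show False
        by (cases s) (auto simp: xlit_def xvar_def)
    qed
    ultimately have "xlit (\<not> s) j r \<in> clause b"
      using literal_persists[OF that(1)] by (metis var_of_xlit xvar_flip)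
    moreover have "xlit (\<not> s) j r \<noteq> Neg ?y"
      by (auto simp: xlit_def cvar_def)
    ultimately show ?thesis using res(8) by blast
  qed
  have falsifies_parent: "falsifies (override ?C \<alpha> \<gamma>) (clause (if \<gamma> ?y then b else a))" for \<gamma>
    unfolding falsifies_def
  proof
    fix l assume "l \<in> clause (if \<gamma> ?y then b else a)"
    then consider "l \<in> ?C" | "l = (if \<gamma> ?y then Neg ?y else Pos ?y)"
      using res(8) by (auto split: if_splits)
    then show "\<not> sat (override ?C \<alpha> \<gamma>) l"
    proof cases
      case 1
      then show ?thesis using falsifies_override[OF \<alpha>] by (auto simp: falsifies_def)
    next
      case 2
      then show ?thesis using cvC by (cases "\<gamma> ?y") (auto simp: override_def)
    qed
  qed
  \<comment> \<open>Polarity \<open>t = s\<close> counts rows and \<open>t = (\<not> s)\<close>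
    counts columns (for \<open>s\<close> true).\<close>
  have wide: "n \<le> card ?C" if all: "\<And>k. k \<in> {1..n} \<Longrightarrow> \<exists>j. xlit t k j \<in> ?C" for t
  proof -
    obtain g where g: "\<And>k. k \<in> {1..n} \<Longrightarrow> xlit t k (g k) \<in> ?C" using all by metis
    have "inj_on (\<lambda>k. xlit t k (g k)) {1..n}"
      by (auto simp: inj_on_def xlit_def split: if_splits)
    moreover have "(\<lambda>k. xlit t k (g k)) ` {1..n} \<subseteq> ?C" using g by auto
    ultimately have "card {1..n} \<le> card ?C" using finC by (rule card_inj_on_le)
    then show ?thesis by simp
  qed
  note sats = falsifies_def short_clause_def long_clause_def sat_zlit override_def cvC cr_asg_simps
  show ?thesis
  proof (cases "\<exists>j. xlit s r j \<in> ?C")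
    case True
    then obtain j where j: "xlit s r j \<in> ?C" by blast
    have "xlit s r j \<in> clause a" using j res(8) b_no_xlit[of b j] by auto
    then obtain k D where k: "edge\<^sup>*\<^sup>* k a" "inference k = Axiom D" "xlit s r j \<in> D"
      using literal_origin[OF al] by blast
    have kl: "k < length \<pi>" using reach_less[OF k(1) al] .
    have D: "D = short_clause s r j"
      using xlit_in_matrix_clause[OF axiomD(1)[OF kl k(2)] k(3)] .
    have jn: "j \<in> {1..n}" using j sub by (metis image_subset_iff var_of_xlit xvar_in_xvars)
    have ck: "clause k = {xlit s r j, Pos ?y}"
      using axiomD(2)[OF kl k(2)] D ex_subclause_short_clause[OF r jn] by simp
    \<comment> \<open>A step out of the axiom \<open>k\<close> would resolve on one of its two
      variables: one still occurs in \<open>?C\<close>, the other is the pivot at \<open>i\<close>.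
      Regularity forbids both.\<close>
    have "k = a"
    proof (rule ccontr)
      assume "k \<noteq> a"
      with k(1) obtain p where p: "edge k p" "edge\<^sup>*\<^sup>* p a" by (meson converse_rtranclpE)
      from p(1) obtain c d x where e: "p < length \<pi>" "inference p = Resolve c d x" "k = c \<or> k = d"
        by (rule edgeE)
      have "Pos x \<in> clause k \<or> Neg x \<in> clause k" using e(3) resolveD(6,7)[OF e(1,2)] by blast
      then have "x = xvar s r j \<or> x = ?y"
        unfolding ck by (metis empty_iff insert_iff var_of.simps var_of_xlit)
      moreover have "edge\<^sup>*\<^sup>* p i" using p(2) res(3) by simp
      with no_pivot_above_literal[OF ir j] e(2) have "x \<noteq> xvar s r j" by auto
      ultimately show False using no_pivot_y[OF p(2)] e(2) by blast
    qed
    have strat_a: "strat a \<epsilon> = zval (\<not> s)" if "\<epsilon> \<in> assignments (xvars n)" for \<epsilon>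
      using axiomD(3)[OF kl k(2) that] D \<open>k = a\<close> by (simp add: falsifying_short_clause)
    show ?thesis
    proof (rule wide[of s], rule ccontr)
      fix k assume k: "k \<in> {1..n}" and none: "\<not> (\<exists>j. xlit s k j \<in> ?C)"
      then have "k \<noteq> r" using j by blast
      \<comment> \<open>Row \<open>k\<close> is satisfied by its \<open>X\<close> literals and the
        other rows by \<open>cvar s\<close>; the false \<open>cvar s k\<close> satisfies the long
        clause. As \<open>k\<close> differs from \<open>r\<close>, the falsified parent is
        \<open>b\<close>.\<close>
      define \<gamma> where "\<gamma> = cr_asg s (\<lambda>_ _. True) False (\<lambda>k'. k' \<noteq> k) (\<lambda>_. False)"
      let ?\<beta> = "override ?C \<alpha> \<gamma>"
      have "\<gamma> ?y" using \<open>k \<noteq> r\<close> by (simp add: \<gamma>_def cr_asg_simps)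
      then have "falsifies ?\<beta> (clause b)" using falsifies_parent[of \<gamma>] by simp
      moreover have "\<not> falsifies ?\<beta> D" if "D \<in> matrix (CR n)" for D
        using that
      proof (cases rule: matrix_CR_cases[where s = s])
        case (1 i' j')
        have "sat ?\<beta> (xlit s k j')"
          using none by (intro sat_override[OF \<alpha>]) (auto simp: \<gamma>_def cr_asg_simps)
        with 1 show ?thesis by (cases "i' = k") (auto simp: sats \<gamma>_def)
      next
        case (2 i' j')
        then show ?thesis by (auto simp: sats \<gamma>_def)
      next
        case 3
        with k show ?thesis by (auto simp: sats \<gamma>_def)
      next
        case 4
        have "1 \<in> {1..n}" using n_ge_2 by simp
        with 4 show ?thesis by (auto simp: sats \<gamma>_def)
      qed
      ultimately have "strat b (restrict_asg (xvars n) ?\<beta>) = zval (\<not> ?\<beta> Z)"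
        by (intro strat_forced[OF bl]) auto
      also have "?\<beta> Z = (\<not> s)" by (auto simp: sats \<gamma>_def)
      finally show False
        using res(10)[OF cv[OF r] restrict_asg_in_assignments[of _ ?\<beta>]]
          strat_a[OF restrict_asg_in_assignments[of _ ?\<beta>]]
        by (cases s) (auto simp: value_consistent_def zval_def)
    qed
  next
    case False
    show ?thesis
    proof (rule wide[of "\<not> s"], rule ccontr)
      fix c assume c: "c \<in> {1..n}" and none: "\<not> (\<exists>k. xlit (\<not> s) c k \<in> ?C)"
      \<comment> \<open>The two assignments agree on the \<open>X\<close> variables but differ in
        \<open>Z\<close> and in the pivot, so they test both parents at the same strategy
        argument.\<close>
      define \<gamma> where "\<gamma> = cr_asg s (\<lambda>k j. k = r) False (\<lambda>k. k \<noteq> r) (\<lambda>_. False)"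
      define \<gamma>' where "\<gamma>' = cr_asg s (\<lambda>k j. k = r) True (\<lambda>k. k = r) (\<lambda>j. j \<noteq> c)"
      let ?\<beta> = "override ?C \<alpha> \<gamma>" and ?\<beta>' = "override ?C \<alpha> \<gamma>'"
      have eq: "restrict_asg (xvars n) ?\<beta> = restrict_asg (xvars n) ?\<beta>'"
        by (rule restrict_asg_cong)
          (auto simp: override_def \<gamma>_def \<gamma>'_def cr_asg_def xvars_def)
      have "falsifies ?\<beta> (clause a)" "falsifies ?\<beta>' (clause b)"
        using falsifies_parent[of \<gamma>] falsifies_parent[of \<gamma>']
        by (simp_all add: \<gamma>_def \<gamma>'_def cr_asg_simps)
      moreover have "\<not> falsifies ?\<beta> D" if "D \<in> matrix (CR n)" for D
        using that
      proof (cases rule: matrix_CR_cases[where s = s])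
        case (1 i' j')
        have "sat ?\<beta> (xlit s r j')"
          using False by (intro sat_override[OF \<alpha>]) (auto simp: \<gamma>_def cr_asg_simps)
        with 1 show ?thesis by (cases "i' = r") (auto simp: sats \<gamma>_def)
      next
        case (2 i' j')
        then show ?thesis by (auto simp: sats \<gamma>_def)
      next
        case 3
        with r show ?thesis by (auto simp: sats \<gamma>_def)
      next
        case 4
        with r show ?thesis by (auto simp: sats \<gamma>_def)
      qed
      moreover have "\<not> falsifies ?\<beta>' D"
        if D: "edge\<^sup>*\<^sup>* k b" "inference k = Axiom D" "D \<in> matrix (CR n)" for k D
        using D(3)
      proof (cases rule: matrix_CR_cases[where s = s])
        case (1 i' j')
        then show ?thesis by (auto simp: sats \<gamma>'_def)
      next
        case (2 i' j')
        show ?thesis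
        proof (cases "i' = c")
          case True
          have "j' \<noteq> r" using b_compl_short[OF D(1)] D(2) 2 True none by blast
          then have "sat ?\<beta>' (xlit (\<not> s) c j')"
            using none by (intro sat_override[OF \<alpha>]) (auto simp: \<gamma>'_def cr_asg_simps)
          with 2 True show ?thesis by (auto simp: sats \<gamma>'_def)
        qed (use 2 in \<open>auto simp: sats \<gamma>'_def\<close>)
      next
        case 3
        \<comment> \<open>Under \<open>\<gamma>'\<close> only \<open>cvar s r\<close> is true, so a
          second index is needed to satisfy the long clause; this uses
          \<open>n_ge_2\<close>.\<close>
        obtain r' where "r' \<in> {1..n}" "r' \<noteq> r"
        proof (cases "r = 1")
          case True
          with that[of 2] n_ge_2 show thesis by simp
        next
          case False
          with that[of 1] n_ge_2 show thesis by simp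
        qed
        with 3 show ?thesis by (auto simp: sats \<gamma>'_def)
      next
        case 4
        with c show ?thesis by (auto simp: sats \<gamma>'_def)
      qed
      ultimately have "strat a (restrict_asg (xvars n) ?\<beta>) = zval (\<not> ?\<beta> Z)"
        "strat b (restrict_asg (xvars n) ?\<beta>') = zval (\<not> ?\<beta>' Z)"
        by (intro strat_forced al bl; blast)+
      moreover have "?\<beta> Z = (\<not> s)" "?\<beta>' Z = s" by (auto simp: sats \<gamma>_def \<gamma>'_def)
      ultimately show False
        using res(10)[OF cv[OF r] restrict_asg_in_assignments[of _ ?\<beta>]] eq
        by (cases s) (auto simp: value_consistent_def zval_def)
    qed
  qed
qed

section \<open>Wide falsified clauses and the counting bound\<close>

text \<open>Ensures that the walk from the root cannot end in a leaf before it meets a third-block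
  pivot.\<close>

lemma axiom_not_over_xvars:
  assumes "i < length \<pi>" "inference i = Axiom C"
  shows "\<not> var_of ` clause i \<subseteq> xvars n"
proof -
  have one: "1 \<in> {1..n}" using n_ge_2 by simp
  have "\<exists>s k. k \<in> {1..n} \<and> (Pos (cvar s k) \<in> C \<or> Neg (cvar s k) \<in> C)"
    using axiomD(1)[OF assms]
  proof (cases rule: matrix_CR_cases[where s = True])
    case 3
    with one show ?thesis unfolding long_clause_def by blast
  next
    case 4
    with one show ?thesis unfolding long_clause_def by blast
  qed (auto simp: short_clause_def)
  then obtain s k where k: "k \<in> {1..n}" "Pos (cvar s k) \<in> C \<or> Neg (cvar s k) \<in> C" by blast
  then have "cvar s k \<in> ex_vars (CR n)" by (auto simp: ex_vars_CR cvars_def)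
  with k(2) have "cvar s k \<in> var_of ` clause i"
    unfolding axiomD(2)[OF assms] ex_subclause_def by force
  then show ?thesis using cvar_notin_xvars by blast
qed

text \<open>Following \<open>\<alpha>\<close> upwards from the root through the pivots in the first block.\<close>

lemma falsified_wide_clause:
  assumes "edge\<^sup>*\<^sup>* i root" "var_of ` clause i \<subseteq> xvars n" "falsifies \<alpha> (clause i)"
  shows "\<exists>k < length \<pi>. n \<le> card (clause k) \<and> var_of ` clause k \<subseteq> xvars n \<and> falsifies \<alpha> (clause k)"
  using assms
proof (induction i rule: less_induct)
  case (less i)
  have il: "i < length \<pi>" using reach_less[OF less.prems(1)] length_pos by simp
  show ?case
  proof (cases "inference i")
    case (Axiom C)
    with axiom_not_over_xvars[OF il] less.prems(2) show ?thesis by blast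
  next
    case (Resolve a b x)
    note r = resolveD[OF il Resolve]
    show ?thesis
    proof (cases "x \<in> xvars n")
      case True
      define c where "c = (if \<alpha> x then b else a)"
      have c: "c < i" "edge c i" using r by (auto simp: c_def)
      have cl: "l \<in> clause i \<or> l = (if \<alpha> x then Neg x else Pos x)" if "l \<in> clause c" for l
        using that r(8) by (auto simp: c_def split: if_splits)
      have "falsifies \<alpha> (clause c)"
        unfolding falsifies_def
      proof
        fix l assume "l \<in> clause c"
        with cl[OF this] less.prems(3) show "\<not> sat \<alpha> l"
          by (cases "\<alpha> x") (auto simp: falsifies_def)
      qed
      moreover have "var_of ` clause c \<subseteq> xvars n"
        using cl less.prems(2) True by (force split: if_splits)
      moreover have "edge\<^sup>*\<^sup>* c root" using c(2) less.prems(1) by simp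
      ultimately show ?thesis using less.IH c(1) by blast
    next
      case False
      then obtain s k where "x = cvar s k" "k \<in> {1..n}"
        using r(5) by (auto simp: cvars_def)
      with wide_clause less.prems Resolve il show ?thesis by blast
    qed
  qed
qed

text \<open>Union bound: every first-block assignment, encoded as its set of true variables,
  falsifies some wide clause, and each such clause covers at most a fraction \<open>2 ^ (-n)\<close>
  of them.\<close>

lemma size_lower_bound: "2 ^ n \<le> length \<pi>"
proof -
  let ?V = "xvars n"
  let ?K = "{k. k < length \<pi> \<and> n \<le> card (clause k) \<and> var_of ` clause k \<subseteq> ?V}"
  let ?F = "\<lambda>k. {T \<in> Pow ?V. falsifies (\<lambda>v. v \<in> T) (clause k)}"
  have "Pow ?V \<subseteq> (\<Union>k\<in>?K. ?F k)"
    using falsified_wide_clause[of root] clause_root by (force simp: falsifies_def)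
  then have "card (Pow ?V) \<le> card (\<Union>k\<in>?K. ?F k)"
    using finite_xvars by (intro card_mono) auto
  also have "\<dots> \<le> (\<Sum>k\<in>?K. card (?F k))" by (rule card_UN_le) simp
  finally have "2 ^ card ?V * 2 ^ n \<le> (\<Sum>k\<in>?K. card (?F k) * 2 ^ n)"
    using finite_xvars by (simp add: card_Pow flip: sum_distrib_right)
  also have "\<dots> \<le> (\<Sum>k\<in>?K. 2 ^ card ?V)"
  proof (rule sum_mono)
    fix k assume "k \<in> ?K"
    moreover from this have "finite (clause k)"
      using n_ge_2 by (auto intro: card_ge_0_finite)
    ultimately show "card (?F k) * 2 ^ n \<le> 2 ^ card ?V"
      by (intro card_falsifying_subsets finite_xvars) auto
  qed
  also have "\<dots> \<le> 2 ^ card ?V * length \<pi>"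
    using card_mono[of "{..<length \<pi>}" ?K] by auto
  finally show ?thesis by simp
qed

end

theorem theorem16:
  fixes R :: "('r, cr_var) representation"
  assumes "complete_representation R"
  shows "\<exists>c::real. c > 0 \<and> (\<exists>N::nat. \<forall>n \<ge> N. \<forall>\<pi> :: ('r, cr_var) line_seq.
           mres_refutation R (CR n) \<pi> \<and> regular \<pi> \<longrightarrow>
           2 powr (c * real n) \<le> real (proof_size \<pi>))"
proof (intro exI conjI allI impI)
  \<comment> \<open>The constants are \<open>c = 1\<close> and \<open>N = 2\<close>.\<close>
  show "(0::real) < 1" by simp
next
  fix n :: nat and \<pi> :: "('r, cr_var) line_seq"
  assume "2 \<le> n" "mres_refutation R (CR n) \<pi> \<and> regular \<pi>"
  then interpret cr_refutation R n \<pi> by unfold_locales auto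
  have "real (2 ^ n) \<le> real (length \<pi>)"
    using size_lower_bound by (simp only: of_nat_le_iff)
  then show "2 powr (1 * real n) \<le> real (proof_size \<pi>)"
    by (simp add: proof_size_def powr_realpow)
qed

end
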